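(* For all positive integers $n,p$, $\mathtt{SS}(n,p)=\Omega\left(\dfrac{\beta(n,p,\infty)}{p}\right)$.
   Context: For a directed graph $G=(V,E)$, a $\Delta$-diameter-reducing shortcut set is a set $H$ of additional directed edges, each in the transitive closure of $G$, such that for all $s,t\in V$ for which $G$ has an $s\leadsto t$ path, $\mathrm{dist}_{G\cup H}(s,t)\le\Delta$ (unweighted hop distance). $\mathtt{SS}(n,p)$ is the smallest integer $\Delta$ such that every $n$-node directed graph has a $\Delta$-diameter-reducing shortcut set of $|H|=p$ edges. A path system is $S=(V,\Pi)$ with $V$ a finite set of nodes and $\Pi$ a multiset of node sequences (paths), each containing each node at most once; size $\|S\|=\sum_\pi|\pi|$ ($|\pi|$ = number of nodes). Write $x<_\pi y$ if $x$ strictly precedes $y$ in $\pi$. A $b$-bridge: $b$ distinct nodes $v_1,\dots,v_b$ and $b$ distinct paths $\pi_1,\dots,\pi_b$ with $v_i<_{\pi_i}v_{i+1}$ ($1\le i\le b-1$) and $v_1<_{\pi_b}v_b$. Bridge girth = least $b$ admitting a $b$-bridge ($\infty$ if none). $\beta(n,p,k)$ = maximum size of a path system with $n$ nodes, $p$ paths and bridge girth $>k$.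
   Formalization: The bound is stated for all p ≥ 1 and all n above a fixed threshold, because at n = 1 it fails (SS(1,p) = 0 while β(1,p,∞) = p); shortcut sets have at most p edges, since exactly p may not exist. *)

theory Defs
  imports Main "HOL-Library.Extended_Nat"
begin

definition diam_reducing_shortcut_set ::
  "(nat \<times> nat) set \<Rightarrow> (nat \<times> nat) set \<Rightarrow> nat \<Rightarrow> bool" where
  "diam_reducing_shortcut_set E H \<Delta> \<longleftrightarrow>
     H \<subseteq> E\<^sup>+ \<and>
     (\<forall>s t. (s, t) \<in> E\<^sup>* \<longrightarrow> (\<exists>k\<le>\<Delta>. (s, t) \<in> (E \<union> H) ^^ k))"

definition SS :: "nat \<Rightarrow> nat \<Rightarrow> nat" where
  "SS n p = (LEAST \<Delta>. \<forall>E. E \<subseteq> {..<n} \<times> {..<n} \<longrightarrow>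
       (\<exists>H. card H \<le> p \<and> diam_reducing_shortcut_set E H \<Delta>))"

text \<open>A path system with node set {..<n} and p paths is a list of p
  node sequences (lists of distinct nodes of {..<n}); the list indices make the
  paths a multiset in which copies are distinct paths.\<close>

definition path_system :: "nat \<Rightarrow> nat \<Rightarrow> nat list list \<Rightarrow> bool" where
  "path_system n p \<Pi> \<longleftrightarrow> length \<Pi> = p \<and>
     (\<forall>\<pi>\<in>set \<Pi>. distinct \<pi> \<and> set \<pi> \<subseteq> {..<n})"

definition ps_size :: "nat list list \<Rightarrow> nat" where
  "ps_size \<Pi> = (\<Sum>\<pi>\<leftarrow>\<Pi>. length \<pi>)"

definition precedes :: "nat list \<Rightarrow> nat \<Rightarrow> nat \<Rightarrow> bool" where
  "precedes \<pi> x y \<longleftrightarrow> (\<exists>i j. i < j \<and> j < length \<pi> \<and> \<pi> ! i = x \<and> \<pi> ! j = y)"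

definition has_bridge :: "nat list list \<Rightarrow> nat \<Rightarrow> bool" where
  "has_bridge \<Pi> b \<longleftrightarrow> b \<ge> 1 \<and>
     (\<exists>vs is. length vs = b \<and> distinct vs \<and> length is = b \<and> distinct is \<and>
        (\<forall>i\<in>set is. i < length \<Pi>) \<and>
        (\<forall>i. i + 1 < b \<longrightarrow> precedes (\<Pi> ! (is ! i)) (vs ! i) (vs ! (i + 1))) \<and>
        precedes (\<Pi> ! (is ! (b - 1))) (vs ! 0) (vs ! (b - 1)))"

definition bridge_girth_gt :: "nat list list \<Rightarrow> enat \<Rightarrow> bool" where
  "bridge_girth_gt \<Pi> k \<longleftrightarrow> (\<forall>b. enat b \<le> k \<longrightarrow> \<not> has_bridge \<Pi> b)"

definition beta :: "nat \<Rightarrow> nat \<Rightarrow> enat \<Rightarrow> nat" where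
  "beta n p k = Max {ps_size \<Pi> | \<Pi>. path_system n p \<Pi> \<and> bridge_girth_gt \<Pi> k}"

end

theory Submission
  imports Defs "HOL-Library.Sublist" Complex_Main
begin

text \<open>A bridgeless system becomes acyclic after deleting at most three incidences per node.
  Indeed, the end of a maximal walk that uses each path in one contiguous run is the final node
  of all but at most three paths through it; delete the node and iterate.

  In an acyclic bridgeless system any two nodes of a path are joined only by that path, so a
  shortcut helps only the one path that contains both of its ends. Hence if p shortcuts reduce
  the diameter to \<Delta>, the p paths have O(p \<Delta>) nodes in total. The 3n deleted incidences
  do not matter, because a single path on all n nodes already forces \<Delta> to be of order at
  least n/p.\<close>

section \<open>Precedence along a path\<close>

text \<open>Excluding bridges does not exclude directed cycles: the paths \<open>[x, y]\<close>,
  \<open>[y, x]\<close> and \<open>[x, z]\<close> contain no bridge, yet x, y, x, z is a walk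
  between two nodes of \<open>[x, z]\<close> through a node off that path. Deleting incidences is
  the remedy: in the thinned system connections between nodes of a path are unique.

  Acyclicity is recorded as a rank on the nodes that increases strictly along every path. The rank
  does two jobs. It makes reachability between two nodes of a path agree with their order on it, and
  it allows an arbitrary walk to be pruned to one with distinct nodes and distinct paths, the only
  form in which a walk can be part of a bridge.\<close>

definition adjacent :: "nat list \<Rightarrow> nat \<Rightarrow> nat \<Rightarrow> bool" where
  "adjacent \<pi> x y \<longleftrightarrow> (\<exists>k. Suc k < length \<pi> \<and> \<pi> ! k = x \<and> \<pi> ! Suc k = y)"

lemma precedes_in_set:
  assumes "precedes \<pi> x y"
  shows "x \<in> set \<pi>" "y \<in> set \<pi>"
  using assms unfolding precedes_def by auto

lemma precedes_trans:
  assumes "distinct \<pi>" "precedes \<pi> x y" "precedes \<pi> y z"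
  shows "precedes \<pi> x z"
proof -
  obtain i j where ij: "i < j" "j < length \<pi>" "\<pi> ! i = x" "\<pi> ! j = y"
    using assms(2) unfolding precedes_def by blast
  obtain k l where kl: "k < l" "l < length \<pi>" "\<pi> ! k = y" "\<pi> ! l = z"
    using assms(3) unfolding precedes_def by blast
  have "j = k"
    using assms(1) ij kl nth_eq_iff_index_eq[of \<pi> j k] by simp
  then show ?thesis
    unfolding precedes_def using ij kl by (intro exI[of _ i] exI[of _ l]) simp
qed

lemma precedes_total:
  assumes "x \<in> set \<pi>" "y \<in> set \<pi>" "x \<noteq> y"
  shows "precedes \<pi> x y \<or> precedes \<pi> y x"
proof -
  obtain i j where "i < length \<pi>" "\<pi> ! i = x" "j < length \<pi>" "\<pi> ! j = y"
    using assms by (meson in_set_conv_nth)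
  then show ?thesis
    unfolding precedes_def using assms(3) by (metis nat_neq_iff)
qed

lemma precedes_irrefl: "distinct \<pi> \<Longrightarrow> \<not> precedes \<pi> x x"
  unfolding precedes_def by (metis nat_neq_iff nth_eq_iff_index_eq less_trans)

lemma adjacent_imp_precedes: "adjacent \<pi> x y \<Longrightarrow> precedes \<pi> x y"
  unfolding adjacent_def precedes_def by blast

lemma adjacent_no_between:
  assumes "distinct \<pi>" "adjacent \<pi> x y" "precedes \<pi> x v" "precedes \<pi> v y"
  shows False
proof -
  obtain k where k: "Suc k < length \<pi>" "\<pi> ! k = x" "\<pi> ! Suc k = y"
    using assms(2) unfolding adjacent_def by blast
  obtain i j where ij: "i < j" "j < length \<pi>" "\<pi> ! i = x" "\<pi> ! j = v"
    using assms(3) unfolding precedes_def by blast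
  obtain i' j' where ij': "i' < j'" "j' < length \<pi>" "\<pi> ! i' = v" "\<pi> ! j' = y"
    using assms(4) unfolding precedes_def by blast
  have "i = k" "j = i'" "j' = Suc k"
    using assms(1) k ij ij' nth_eq_iff_index_eq[of \<pi> i k]
      nth_eq_iff_index_eq[of \<pi> j i'] nth_eq_iff_index_eq[of \<pi> j' "Suc k"] by simp_all
  then show False using ij ij' by simp
qed

lemma not_last_imp_adjacent:
  assumes "v \<in> set \<pi>" "v \<noteq> last \<pi>"
  shows "\<exists>s. adjacent \<pi> v s"
proof -
  obtain k where k: "k < length \<pi>" "\<pi> ! k = v" using assms(1) by (meson in_set_conv_nth)
  have "k \<noteq> length \<pi> - 1"
    using k assms by (metis last_conv_nth list.size(3) not_less_zero)
  then have "Suc k < length \<pi>" using k by simp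
  then show ?thesis unfolding adjacent_def using k by blast
qed

lemma precedes_conv_subseq: "precedes \<pi> x y \<longleftrightarrow> subseq [x, y] \<pi>"
proof
  assume "precedes \<pi> x y"
  then obtain i j where ij: "i < j" "j < length \<pi>" "\<pi> ! i = x" "\<pi> ! j = y"
    unfolding precedes_def by blast
  have "\<pi> = take i \<pi> @ x # drop (Suc i) \<pi>"
    using ij id_take_nth_drop[of i \<pi>] by simp
  moreover have "y \<in> set (drop (Suc i) \<pi>)"
    using ij by (auto simp: in_set_conv_nth intro!: exI[of _ "j - Suc i"])
  ultimately show "subseq [x, y] \<pi>"
    by (metis subseq_Cons2 subseq_singleton_left list_emb_append2)
next
  assume "subseq [x, y] \<pi>"
  then obtain as zs where 1: "\<pi> = as @ x # zs" "subseq [y] zs"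
    by (auto dest!: list_emb_ConsD)
  then obtain bs cs where 2: "zs = bs @ y # cs"
    by (auto simp: subseq_singleton_left dest: split_list)
  show "precedes \<pi> x y"
    unfolding precedes_def 1 2
    by (rule exI[of _ "length as"], rule exI[of _ "Suc (length as + length bs)"])
       (simp add: nth_append)
qed

lemma subseq_set_subset: "subseq xs ys \<Longrightarrow> set xs \<subseteq> set ys"
  by (auto elim: list_emb_set)

lemma subseq_precedes: "subseq \<pi> \<rho> \<Longrightarrow> precedes \<pi> x y \<Longrightarrow> precedes \<rho> x y"
  unfolding precedes_conv_subseq by (rule subseq_order.trans)

section \<open>Routes and bridges\<close>

text \<open>A route is a bridge without its closing path: its b nodes and the first b - 1 paths. One
  further path, not in \<open>cs\<close>, that meets the first node before the last one completes
  the bridge.\<close>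

inductive route :: "nat list list \<Rightarrow> nat list \<Rightarrow> nat list \<Rightarrow> bool" for \<Pi> where
  start: "route \<Pi> [x] []"
| snoc: "route \<Pi> vs cs \<Longrightarrow> c < length \<Pi> \<Longrightarrow> precedes (\<Pi> ! c) (last vs) y \<Longrightarrow>
     y \<notin> set vs \<Longrightarrow> c \<notin> set cs \<Longrightarrow> route \<Pi> (vs @ [y]) (cs @ [c])"

lemma route_nonempty: "route \<Pi> vs cs \<Longrightarrow> vs \<noteq> []"
  by (induction rule: route.induct) auto

lemma route_nth:
  "route \<Pi> vs cs \<Longrightarrow> length vs = Suc (length cs) \<and> distinct vs \<and> distinct cs \<and>
     (\<forall>i<length cs. cs ! i < length \<Pi> \<and> precedes (\<Pi> ! (cs ! i)) (vs ! i) (vs ! Suc i))"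
proof (induction rule: route.induct)
  case (snoc vs cs c y)
  have "last vs = vs ! length cs"
    using snoc.IH by (metis diff_Suc_1 last_conv_nth length_0_conv nat.distinct(1))
  then show ?case
    using snoc by (auto simp: nth_append less_Suc_eq)
qed simp

lemma route_Cons:
  "route \<Pi> vs cs \<Longrightarrow> c < length \<Pi> \<Longrightarrow> precedes (\<Pi> ! c) x (hd vs) \<Longrightarrow>
     x \<notin> set vs \<Longrightarrow> c \<notin> set cs \<Longrightarrow> route \<Pi> (x # vs) (c # cs)"
proof (induction rule: route.induct)
  case (start y)
  then show ?case
    using route.snoc[OF route.start[of \<Pi> x], of c y] by auto
next
  case (snoc vs cs d y)
  note ne = route_nonempty[OF snoc.hyps(1)]
  have "route \<Pi> (x # vs) (c # cs)" using snoc ne by simp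
  from route.snoc[OF this, of d y] show ?case using snoc ne by auto
qed

text \<open>A route may not repeat a path, so a walk that continues along its current path must have
  its last arc prolonged; transitivity of precedence on that path permits this.\<close>

lemma route_lengthen_last:
  assumes "route \<Pi> vs cs" "cs \<noteq> []" "\<forall>\<pi>\<in>set \<Pi>. distinct \<pi>"
    and "precedes (\<Pi> ! last cs) (last vs) y" "y \<notin> set vs"
  shows "route \<Pi> (butlast vs @ [y]) cs"
  using assms(1)
proof cases
  case (snoc vs' cs' c z)
  have "precedes (\<Pi> ! c) (last vs') y"
    using precedes_trans[of "\<Pi> ! c" "last vs'" z y] snoc assms by simp
  then show ?thesis using route.snoc[of \<Pi> vs' cs' c y] snoc assms by simp
qed (use assms in simp)

lemma route_imp_bridge:
  assumes "route \<Pi> vs cs" "cs \<noteq> []" "r < length \<Pi>" "r \<notin> set cs"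
    and "precedes (\<Pi> ! r) (hd vs) (last vs)"
  shows "has_bridge \<Pi> (length vs)"
proof -
  note R = route_nth[OF assms(1)]
  have ne: "vs \<noteq> []" using R by auto
  show ?thesis
    unfolding has_bridge_def
  proof (rule conjI, use ne in \<open>simp add: Suc_le_eq\<close>, rule exI[of _ vs], rule exI[of _ "cs @ [r]"],
      intro conjI allI impI)
    show "\<forall>i\<in>set (cs @ [r]). i < length \<Pi>"
      using R assms(3) by (auto simp: in_set_conv_nth)
  next
    fix i assume "i + 1 < length vs"
    then show "precedes (\<Pi> ! ((cs @ [r]) ! i)) (vs ! i) (vs ! (i + 1))"
      using R by (simp add: nth_append)
  next
    have "(cs @ [r]) ! (length vs - 1) = r" using R by simp
    then show "precedes (\<Pi> ! ((cs @ [r]) ! (length vs - 1))) (vs ! 0) (vs ! (length vs - 1))"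
      using assms(5) ne by (simp add: hd_conv_nth last_conv_nth)
  qed (use R assms in auto)
qed

lemma bridgeless_route:
  assumes "bridge_girth_gt \<Pi> \<infinity>" "route \<Pi> vs cs" "cs \<noteq> []" "r < length \<Pi>" "r \<notin> set cs"
    and "precedes (\<Pi> ! r) (hd vs) (last vs)"
  shows False
  using route_imp_bridge[OF assms(2-)] assms(1) unfolding bridge_girth_gt_def by auto

text \<open>Otherwise \<open>c\<close> and \<open>d\<close> would form a 2-bridge on
  \<open>x\<close> and \<open>y\<close>. So an ordered pair of nodes identifies its path, which is
  used below to tell apart edges, shortcuts and blocks.\<close>

lemma bridgeless_common_pair:
  assumes "bridge_girth_gt \<Pi> \<infinity>" "\<forall>\<pi>\<in>set \<Pi>. distinct \<pi>"
    and "c < length \<Pi>" "d < length \<Pi>" "precedes (\<Pi> ! c) x y" "precedes (\<Pi> ! d) x y"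
  shows "c = d"
proof (rule ccontr)
  assume "c \<noteq> d"
  have "x \<noteq> y" using assms precedes_irrefl by (metis nth_mem)
  then have "route \<Pi> [x, y] [c]"
    using route.snoc[OF route.start[of \<Pi> x], of c y] assms by simp
  then show False
    using bridgeless_route[of \<Pi> "[x, y]" "[c]" d] assms \<open>c \<noteq> d\<close> by simp
qed

lemma has_bridge_mono:
  assumes "has_bridge \<Pi> b" "length \<Pi>' = length \<Pi>"
    and "\<And>i. i < length \<Pi> \<Longrightarrow> subseq (\<Pi> ! i) (\<Pi>' ! i)"
  shows "has_bridge \<Pi>' b"
proof -
  obtain vs cs where *: "b \<ge> 1" "length vs = b" "distinct vs" "length cs = b" "distinct cs"
      "\<forall>i\<in>set cs. i < length \<Pi>"
      "\<forall>i. i + 1 < b \<longrightarrow> precedes (\<Pi> ! (cs ! i)) (vs ! i) (vs ! (i + 1))"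
      "precedes (\<Pi> ! (cs ! (b - 1))) (vs ! 0) (vs ! (b - 1))"
    using assms(1) unfolding has_bridge_def by blast
  have sub: "subseq (\<Pi> ! (cs ! i)) (\<Pi>' ! (cs ! i))" if "i < b" for i
    using assms(3) * that by simp
  have p1: "precedes (\<Pi>' ! (cs ! i)) (vs ! i) (vs ! (i + 1))" if "i + 1 < b" for i
    using subseq_precedes[OF sub[of i]] * that by simp
  have p2: "precedes (\<Pi>' ! (cs ! (b - 1))) (vs ! 0) (vs ! (b - 1))"
    using subseq_precedes[OF sub[of "b - 1"]] * by simp
  show ?thesis
    unfolding has_bridge_def
    by (rule conjI[OF *(1)], rule exI[of _ vs], rule exI[of _ cs]) (use * p1 p2 assms(2) in simp)
qed

section \<open>A node that ends almost all of its paths\<close>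

text \<open>Steps join consecutive nodes of a path, so that no node of the path fits strictly
  between the ends of a step. The last clause confines each path to one contiguous run, which can be
  contracted to a single arc of a route.\<close>

definition rainbow_walk :: "nat list list \<Rightarrow> nat list \<Rightarrow> nat list \<Rightarrow> bool" where
  "rainbow_walk \<Pi> xs cs \<longleftrightarrow> length xs = Suc (length cs) \<and> distinct xs \<and>
     (\<forall>k<length cs. cs ! k < length \<Pi> \<and> adjacent (\<Pi> ! (cs ! k)) (xs ! k) (xs ! Suc k)) \<and>
     (\<forall>i j k. i < j \<longrightarrow> j < k \<longrightarrow> k < length cs \<longrightarrow> cs ! i = cs ! k \<longrightarrow> cs ! j = cs ! i)"

text \<open>Each run on one path contracts to one arc. A step that leaves the current path cannot
  return to a path used before in the segment, by contiguity, so the new arc has a fresh path. The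
  bounds on \<open>set vs\<close> and \<open>set ds\<close> let later arguments keep additional
  nodes and paths disjoint from the route.\<close>

lemma rainbow_walk_imp_route:
  assumes "rainbow_walk \<Pi> xs cs" "\<forall>\<pi>\<in>set \<Pi>. distinct \<pi>" "i < j" "j \<le> length cs"
  shows "\<exists>vs ds. route \<Pi> vs ds \<and> ds \<noteq> [] \<and> hd vs = xs ! i \<and> last vs = xs ! j \<and>
     set vs \<subseteq> (!) xs ` {i..j} \<and> set ds \<subseteq> (!) cs ` {i..<j} \<and> last ds = cs ! (j - 1)"
  using assms(3,4)
proof (induction j)
  case 0
  then show ?case by simp
next
  case (Suc j)
  have W: "length xs = Suc (length cs)" "distinct xs"
      "\<And>k. k < length cs \<Longrightarrow> cs ! k < length \<Pi> \<and> adjacent (\<Pi> ! (cs ! k)) (xs ! k) (xs ! Suc k)"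
      "\<And>i j k. i < j \<Longrightarrow> j < k \<Longrightarrow> k < length cs \<Longrightarrow> cs ! i = cs ! k \<Longrightarrow> cs ! j = cs ! i"
    using assms(1) unfolding rainbow_walk_def by blast+
  have step: "cs ! j < length \<Pi>" "precedes (\<Pi> ! (cs ! j)) (xs ! j) (xs ! Suc j)"
    using W(3)[of j] Suc.prems adjacent_imp_precedes by auto
  show ?case
  proof (cases "i = j")
    case True
    have "xs ! j \<noteq> xs ! Suc j"
      using W Suc.prems nth_eq_iff_index_eq[of xs j "Suc j"] by simp
    then have "route \<Pi> [xs ! j, xs ! Suc j] [cs ! j]"
      using route.snoc[OF route.start[of \<Pi> "xs ! j"], of "cs ! j" "xs ! Suc j"] step by simp
    then show ?thesis
      using True by (intro exI[of _ "[xs ! j, xs ! Suc j]"] exI[of _ "[cs ! j]"]) auto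
  next
    case False
    then have "i < j" using Suc.prems by simp
    then obtain vs ds where IH: "route \<Pi> vs ds" "ds \<noteq> []" "hd vs = xs ! i" "last vs = xs ! j"
        "set vs \<subseteq> (!) xs ` {i..j}" "set ds \<subseteq> (!) cs ` {i..<j}" "last ds = cs ! (j - 1)"
      using Suc by auto
    have new: "xs ! Suc j \<notin> set vs"
    proof
      assume "xs ! Suc j \<in> set vs"
      from subsetD[OF IH(5) this] obtain k where "k \<le> j" "xs ! Suc j = xs ! k" by auto
      then show False
        using W Suc.prems nth_eq_iff_index_eq[of xs "Suc j" k] by simp
    qed
    have vne: "vs \<noteq> []" using IH(1) route_nonempty by blast
    have sub: "set ds \<subseteq> (!) cs ` {i..<Suc j}"
      using IH(6) by (auto simp: less_Suc_eq)
    show ?thesis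
    proof (cases "cs ! j = last ds")
      case True
      have r: "route \<Pi> (butlast vs @ [xs ! Suc j]) ds"
        using route_lengthen_last[OF IH(1,2) assms(2)] step IH(4) True new by simp
      have "length vs \<ge> 2" using route_nth[OF IH(1)] IH(2) by (cases ds) auto
      then have "hd (butlast vs @ [xs ! Suc j]) = xs ! i"
        using IH(3) by (cases vs; cases "tl vs") auto
      moreover have "set (butlast vs @ [xs ! Suc j]) \<subseteq> (!) xs ` {i..Suc j}"
        using IH(5) Suc.prems by (auto dest!: in_set_butlastD)
      ultimately show ?thesis
        using r IH(2) sub True
        by (intro exI[of _ "butlast vs @ [xs ! Suc j]"] exI[of _ ds]) simp
    next
      case False
      have "cs ! j \<notin> set ds"
      proof
        assume "cs ! j \<in> set ds"
        from subsetD[OF IH(6) this] obtain k where k: "i \<le> k" "k < j" "cs ! j = cs ! k" by auto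
        have "k \<noteq> j - 1" using k False IH(7) by auto
        then have "cs ! (j - 1) = cs ! k"
          using W(4)[of k "j - 1" j] k Suc.prems by simp
        then show False using False IH(7) k by simp
      qed
      then have "route \<Pi> (vs @ [xs ! Suc j]) (ds @ [cs ! j])"
        using route.snoc[OF IH(1)] step IH(4) new by simp
      moreover have "set (vs @ [xs ! Suc j]) \<subseteq> (!) xs ` {i..Suc j}"
        using IH(5) Suc.prems by auto
      moreover have "set (ds @ [cs ! j]) \<subseteq> (!) cs ` {i..<Suc j}"
        using sub Suc.prems by auto
      ultimately show ?thesis
        using IH(3) vne
        by (intro exI[of _ "vs @ [xs ! Suc j]"] exI[of _ "ds @ [cs ! j]"]) simp
    qed
  qed
qed

lemma card_le_1I:
  assumes "finite T" "\<And>x y. x \<in> T \<Longrightarrow> y \<in> T \<Longrightarrow> x = y"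
  shows "card T \<le> 1"
  using card_le_Suc0_iff_eq[OF assms(1)] assms(2) by simp

text \<open>A maximal rainbow walk ends in such a node v. A path leaving v is the last one used
  by the walk, or is used earlier by the walk, or continues to a node of the walk; two paths of
  the second kind, or two of the third kind, would form a bridge with a part of the walk.\<close>

lemma exists_near_sink:
  assumes fin: "finite A" "A \<noteq> {}"
    and paths: "\<forall>\<pi>\<in>set \<Pi>. distinct \<pi> \<and> set \<pi> \<subseteq> A"
    and bl: "bridge_girth_gt \<Pi> \<infinity>"
  shows "\<exists>v\<in>A. card {c. c < length \<Pi> \<and> v \<in> set (\<Pi> ! c) \<and> v \<noteq> last (\<Pi> ! c)} \<le> 3"
proof -
  have dist: "\<forall>\<pi>\<in>set \<Pi>. distinct \<pi>" using paths by blast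
  have distc: "distinct (\<Pi> ! c)" if "c < length \<Pi>" for c using dist that by simp
  define P where "P = (\<lambda>w. rainbow_walk \<Pi> (fst w) (snd w) \<and> set (fst w) \<subseteq> A)"
  obtain a where "a \<in> A" using fin by blast
  then have P1: "P ([a], [])" unfolding P_def rainbow_walk_def by simp
  have P2: "\<forall>w. P w \<longrightarrow> length (fst w) < Suc (card A)"
    unfolding P_def rainbow_walk_def by (metis card_mono distinct_card fin(1) less_Suc_eq_le)
  obtain w where w: "P w" "\<forall>w'. P w' \<longrightarrow> length (fst w') \<le> length (fst w)"
    using ex_has_greatest_nat[OF P1 P2] by blast
  define xs cs where "xs = fst w" and "cs = snd w"
  have rw: "rainbow_walk \<Pi> xs cs" and xsA: "set xs \<subseteq> A"
    using w(1) unfolding P_def xs_def cs_def by auto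
  have maxi: "length xs' \<le> length xs" if "rainbow_walk \<Pi> xs' cs'" "set xs' \<subseteq> A" for xs' cs'
    using w(2) that unfolding P_def xs_def by (metis fst_conv snd_conv)
  have W: "length xs = Suc (length cs)" "distinct xs"
      "\<And>k. k < length cs \<Longrightarrow> cs ! k < length \<Pi> \<and> adjacent (\<Pi> ! (cs ! k)) (xs ! k) (xs ! Suc k)"
      "\<And>i j k. i < j \<Longrightarrow> j < k \<Longrightarrow> k < length cs \<Longrightarrow> cs ! i = cs ! k \<Longrightarrow> cs ! j = cs ! i"
    using rw unfolding rainbow_walk_def by blast+
  note seg = rainbow_walk_imp_route[OF rw dist]
  define m where "m = length cs"
  define v where "v = xs ! m"
  have vA: "v \<in> A" using xsA W(1) unfolding v_def m_def by auto
  have v_neq: "xs ! k \<noteq> v" if "k < m" for k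
    using that W nth_eq_iff_index_eq[of xs k m] unfolding v_def m_def by simp
  define T where "T = {c. c < length \<Pi> \<and> v \<in> set (\<Pi> ! c) \<and> v \<noteq> last (\<Pi> ! c)}"
  \<comment> \<open>The guard concerns the walk without steps, for which \<open>last cs\<close>
    carries no information; all of \<open>T\<close> then falls into \<open>TC\<close>.\<close>
  define TA where "TA = {c \<in> T. cs \<noteq> [] \<and> c = last cs}"
  define TB where "TB = {c \<in> T. c \<in> set cs \<and> c \<noteq> last cs}"
  define TC where "TC = {c \<in> T. c \<notin> set cs}"
  have finT: "finite T" unfolding T_def by simp
  have cTA: "card TA \<le> 1"
    by (rule card_le_1I) (use finT in \<open>auto simp: TA_def\<close>)
  have cTB: "card TB \<le> 1"
  proof (rule card_le_1I)
    show "finite TB" using finT unfolding TB_def by simp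
    \<comment> \<open>Backward induction from the end of the walk. Suppose the head of step
      \<open>t\<close> came before \<open>v\<close> on \<open>c\<close>. If the next step stays on
      \<open>c\<close>, then \<open>v\<close> lies strictly between two consecutive nodes of
      \<open>c\<close>. If not, the walk has left \<open>c\<close> for good, and its part from that
      head to \<open>v\<close> forms a bridge closed by \<open>c\<close>.\<close>
    have before: "precedes (\<Pi> ! c) v (xs ! Suc t)" if c: "c \<in> TB" and t: "t < m" "cs ! t = c" for c t
      using t
    proof (induction "m - t" arbitrary: t rule: less_induct)
      case less
      have cl: "c < length \<Pi>" and cv: "v \<in> set (\<Pi> ! c)" and cne: "c \<noteq> last cs"
        using c unfolding TB_def T_def by auto
      have "cs \<noteq> []" using less.prems unfolding m_def by auto
      then have "t \<noteq> m - 1" using less.prems cne last_conv_nth[of cs] unfolding m_def by auto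
      then have t1: "Suc t < m" using less.prems by simp
      have "xs ! Suc t \<in> set (\<Pi> ! c)"
        using W(3)[of t] less.prems adjacent_imp_precedes precedes_in_set unfolding m_def by blast
      then have alt: "precedes (\<Pi> ! c) v (xs ! Suc t) \<or> precedes (\<Pi> ! c) (xs ! Suc t) v"
        using precedes_total cv v_neq[OF t1] by metis
      have False if after: "precedes (\<Pi> ! c) (xs ! Suc t) v"
      proof (cases "cs ! Suc t = c")
        case True
        have "precedes (\<Pi> ! c) v (xs ! Suc (Suc t))"
          using less.hyps[of "Suc t"] t1 True by simp
        then show False
          using adjacent_no_between[OF distc[OF cl] _ after] W(3)[of "Suc t"] t1 True
          unfolding m_def by blast
      next
        case False
        obtain vs ds where r: "route \<Pi> vs ds" "ds \<noteq> []" "hd vs = xs ! Suc t" "last vs = v"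
            "set ds \<subseteq> (!) cs ` {Suc t..<m}"
          using seg[OF t1] unfolding m_def v_def by blast
        have "c \<notin> set ds"
        proof
          assume "c \<in> set ds"
          from subsetD[OF r(5) this] obtain k where k: "Suc t \<le> k" "k < m" "cs ! k = c" by auto
          then have "k \<noteq> Suc t" using False by auto
          then have "cs ! Suc t = cs ! t"
            using W(4)[of t "Suc t" k] k less.prems unfolding m_def by simp
          then show False using False less.prems by simp
        qed
        then show False using bridgeless_route[OF bl r(1,2) cl] after r by simp
      qed
      then show ?case using alt by blast
    qed
    have before': "precedes (\<Pi> ! c) v (xs ! t)" if c: "c \<in> TB" and t: "t < m" "cs ! t = c" for c t
    proof -
      have cl: "c < length \<Pi>" and cv: "v \<in> set (\<Pi> ! c)" using c unfolding TB_def T_def by auto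
      have adj: "adjacent (\<Pi> ! c) (xs ! t) (xs ! Suc t)" using W(3)[of t] t unfolding m_def by simp
      then have "xs ! t \<in> set (\<Pi> ! c)" using adjacent_imp_precedes precedes_in_set by blast
      then have "precedes (\<Pi> ! c) v (xs ! t) \<or> precedes (\<Pi> ! c) (xs ! t) v"
        using precedes_total cv v_neq[OF t(1)] by metis
      then show ?thesis
        using adjacent_no_between[OF distc[OF cl] adj] before[OF c t] by blast
    qed
    \<comment> \<open>Induction on \<open>t - s\<close> reduces to the case where no step strictly
      between uses \<open>c\<close> or \<open>d\<close>. Then go from \<open>v\<close> along
      \<open>c\<close> to the head of step \<open>s\<close>, follow the walk to the tail of step
      \<open>t\<close>, and close with \<open>d\<close>. Choosing this head and this tail keeps the
      steps \<open>s\<close> and \<open>t\<close> themselves out of the middle part.\<close>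
    have noless: False
      if c: "c \<in> TB" "d \<in> TB" "c \<noteq> d" and s: "s < t" "t < m" "cs ! s = c" "cs ! t = d" for c d s t
      using s
    proof (induction "t - s" arbitrary: s t rule: less_induct)
      case less
      have cl: "c < length \<Pi>" "d < length \<Pi>" using c unfolding TB_def T_def by auto
      show False
      proof (cases "\<exists>k. s < k \<and> k < t \<and> (cs ! k = c \<or> cs ! k = d)")
        case True
        then obtain k where k: "s < k" "k < t" "cs ! k = c \<or> cs ! k = d" by blast
        then have "t - k < t - s" "k - s < t - s" by arith+
        then show False
          using less.hyps[of t k] less.hyps[of k s] less.prems k by auto
      next
        case False
        have bs: "precedes (\<Pi> ! c) v (xs ! Suc s)" using before[of c s] less.prems c by simp
        have bt: "precedes (\<Pi> ! d) v (xs ! t)" using before'[of d t] less.prems c by simp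
        show False
        proof (cases "Suc s = t")
          case True
          then show False
            using bridgeless_common_pair[OF bl dist cl bs] bt c(3) by simp
        next
          case ne: False
          then have st: "Suc s < t" using less.prems by simp
          then obtain vs ds where r: "route \<Pi> vs ds" "ds \<noteq> []" "hd vs = xs ! Suc s"
              "last vs = xs ! t" "set vs \<subseteq> (!) xs ` {Suc s..t}" "set ds \<subseteq> (!) cs ` {Suc s..<t}"
            using seg[OF st] less.prems unfolding m_def by auto
          have "v \<notin> set vs"
          proof
            assume "v \<in> set vs"
            from subsetD[OF r(5) this] obtain q where "q \<le> t" "v = xs ! q" by auto
            then show False using v_neq[of q] less.prems by simp
          qed
          have "e \<notin> set ds" if "e = c \<or> e = d" for e
          proof
            assume "e \<in> set ds"
            from subsetD[OF r(6) this] obtain q where "Suc s \<le> q" "q < t" "e = cs ! q"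
              by auto
            then show False using False that by (auto simp: Suc_le_eq)
          qed
          then have notin: "c \<notin> set ds" "d \<notin> set ds" by blast+
          from \<open>v \<notin> set vs\<close> notin have "route \<Pi> (v # vs) (c # ds)"
            using route_Cons[OF r(1) cl(1)] bs r(3) by simp
          then show False
            using bridgeless_route[OF bl _ _ cl(2), of "v # vs" "c # ds"] notin c(3) bt r(4)
              route_nonempty[OF r(1)] by simp
        qed
      qed
    qed
    fix c d assume cd: "c \<in> TB" "d \<in> TB"
    then obtain s t where st: "s < m" "cs ! s = c" "t < m" "cs ! t = d"
      unfolding TB_def m_def by (auto simp: in_set_conv_nth)
    show "c = d"
    proof (rule ccontr)
      assume "c \<noteq> d"
      then have "s \<noteq> t" using st by auto
      then show False
        using noless[of c d s t] noless[of d c t s] cd st \<open>c \<noteq> d\<close>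
        by (cases s t rule: linorder_cases) auto
    qed
  qed
  have cTC: "card TC \<le> 1"
  proof (rule card_le_1I)
    show "finite TC" using finT unfolding TC_def by simp
    have next_on_walk: "\<exists>k<m. precedes (\<Pi> ! c) v (xs ! k)" if c: "c \<in> TC" for c
    proof -
      have cl: "c < length \<Pi>" and cv: "v \<in> set (\<Pi> ! c)" "v \<noteq> last (\<Pi> ! c)" and cn: "c \<notin> set cs"
        using c unfolding TC_def T_def by auto
      obtain s where s: "adjacent (\<Pi> ! c) v s" using not_last_imp_adjacent cv by blast
      have pre: "precedes (\<Pi> ! c) v s" using s adjacent_imp_precedes by blast
      have "s \<in> set xs"
      proof (rule ccontr)
        assume "s \<notin> set xs"
        have "rainbow_walk \<Pi> (xs @ [s]) (cs @ [c])"
          unfolding rainbow_walk_def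
        proof (intro conjI allI impI)
          fix k assume "k < length (cs @ [c])"
          then show "(cs @ [c]) ! k < length \<Pi>"
            using W(3)[of k] cl by (cases "k = length cs") (simp_all add: nth_append)
        next
          fix k assume k: "k < length (cs @ [c])"
          show "adjacent (\<Pi> ! ((cs @ [c]) ! k)) ((xs @ [s]) ! k) ((xs @ [s]) ! Suc k)"
          proof (cases "k = length cs")
            case True
            then show ?thesis using W(1) s unfolding v_def m_def by (simp add: nth_append)
          next
            case False
            then show ?thesis using W(1) W(3)[of k] k by (simp add: nth_append)
          qed
        next
          fix i j k
          assume ijk: "i < j" "j < k" "k < length (cs @ [c])" "(cs @ [c]) ! i = (cs @ [c]) ! k"
          show "(cs @ [c]) ! j = (cs @ [c]) ! i"
          proof (cases "k = length cs")
            case True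
            then have "cs ! i = c" using ijk by (simp add: nth_append)
            moreover have "cs ! i \<in> set cs" using ijk True by simp
            ultimately show ?thesis using cn by simp
          next
            case False
            then show ?thesis using W(4)[of i j k] ijk by (simp add: nth_append)
          qed
        qed (use W \<open>s \<notin> set xs\<close> in auto)
        moreover have "set (xs @ [s]) \<subseteq> A"
          using xsA precedes_in_set(2)[OF pre] paths cl by (auto dest: nth_mem)
        ultimately show False using maxi by fastforce
      qed
      then obtain k where k: "k < length xs" "xs ! k = s" by (meson in_set_conv_nth)
      moreover have "s \<noteq> v" using pre precedes_irrefl distc[OF cl] by blast
      ultimately have "k < m" using W(1) unfolding v_def m_def by (metis less_SucE)
      then show ?thesis using k pre by blast
    qed
    \<comment> \<open>The same kind of bridge: from \<open>v\<close> along \<open>c\<close> to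
      \<open>xs ! k\<close>, along the walk to \<open>xs ! l\<close>, closed by \<open>d\<close>. No
      closest pair is required, because \<open>c\<close> and \<open>d\<close> do not occur on the
      walk at all.\<close>
    have nolt: False
      if c: "c \<in> TC" "d \<in> TC" "c \<noteq> d" and k: "k < l" "l < m"
        and p: "precedes (\<Pi> ! c) v (xs ! k)" "precedes (\<Pi> ! d) v (xs ! l)" for c d k l
    proof -
      have cl: "c < length \<Pi>" "d < length \<Pi>" and cn: "c \<notin> set cs" "d \<notin> set cs"
        using c unfolding TC_def T_def by auto
      obtain vs ds where r: "route \<Pi> vs ds" "ds \<noteq> []" "hd vs = xs ! k"
          "last vs = xs ! l" "set vs \<subseteq> (!) xs ` {k..l}" "set ds \<subseteq> (!) cs ` {k..<l}"
        using seg[OF k(1)] k unfolding m_def by auto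
      have "v \<notin> set vs"
      proof
        assume "v \<in> set vs"
        from subsetD[OF r(5) this] obtain q where "q \<le> l" "v = xs ! q" by auto
        then show False using v_neq[of q] k by simp
      qed
      moreover have "set ds \<subseteq> set cs" using r(6) k unfolding m_def by fastforce
      ultimately have "route \<Pi> (v # vs) (c # ds)"
        using route_Cons[OF r(1) cl(1)] p(1) r(3) cn by auto
      then show False
        using bridgeless_route[OF bl _ _ cl(2), of "v # vs" "c # ds"] cn c(3) p(2) r(4)
          route_nonempty[OF r(1)] \<open>set ds \<subseteq> set cs\<close> by auto
    qed
    fix c d assume cd: "c \<in> TC" "d \<in> TC"
    obtain k l where kl: "k < m" "precedes (\<Pi> ! c) v (xs ! k)" "l < m" "precedes (\<Pi> ! d) v (xs ! l)"
      using next_on_walk cd by blast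
    have cl: "c < length \<Pi>" "d < length \<Pi>" using cd unfolding TC_def T_def by auto
    show "c = d"
    proof (cases k l rule: linorder_cases)
      case equal
      then show ?thesis using bridgeless_common_pair[OF bl dist cl kl(2)] kl(4) by simp
    qed (use nolt[of c d k l] nolt[of d c l k] cd kl in auto)
  qed
  have "T \<subseteq> TA \<union> TB \<union> TC" unfolding TA_def TB_def TC_def by auto
  moreover have "finite (TA \<union> TB \<union> TC)" using finT unfolding TA_def TB_def TC_def by simp
  ultimately have "card T \<le> card TA + card TB + card TC"
    using card_mono[of "TA \<union> TB \<union> TC" T] card_Un_le[of TA TB] card_Un_le[of "TA \<union> TB" TC]
    by linarith
  then have "card T \<le> 3" using cTA cTB cTC by linarith
  then show ?thesis using vA unfolding T_def by blast
qed

section \<open>Peeling off near-sinks to obtain a ranked subsystem\<close>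

lemma ps_size_nth: "ps_size \<Pi> = (\<Sum>i<length \<Pi>. length (\<Pi> ! i))"
  unfolding ps_size_def by (simp add: sum_list_sum_nth atLeast0LessThan)

lemma bridge_girth_infinity_mono:
  assumes "bridge_girth_gt \<Pi>' \<infinity>" "length \<Pi>' = length \<Pi>"
    and "\<And>i. i < length \<Pi> \<Longrightarrow> subseq (\<Pi> ! i) (\<Pi>' ! i)"
  shows "bridge_girth_gt \<Pi> \<infinity>"
  using assms has_bridge_mono[of \<Pi> _ \<Pi>'] unfolding bridge_girth_gt_def by blast

text \<open>The near-sink \<open>v\<close> is taken out of all paths and the rest is ranked by
  induction. Then \<open>v\<close> is appended again to the paths that it ended, with a rank above
  all others. It is lost only where another node followed it, that is on at most three paths, whence
  3 per node of \<open>A\<close>.\<close>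

lemma exists_ranked_subsystem:
  assumes "finite A" "\<forall>\<pi>\<in>set \<Pi>. distinct \<pi> \<and> set \<pi> \<subseteq> A" "bridge_girth_gt \<Pi> \<infinity>"
  shows "\<exists>\<Pi>' (f :: nat \<Rightarrow> nat). length \<Pi>' = length \<Pi> \<and>
    (\<forall>i<length \<Pi>. subseq (\<Pi>' ! i) (\<Pi> ! i) \<and> sorted_wrt (\<lambda>x y. f x < f y) (\<Pi>' ! i)) \<and>
    ps_size \<Pi> \<le> ps_size \<Pi>' + 3 * card A"
  using assms
proof (induction "card A" arbitrary: A \<Pi>)
  case 0
  then have "\<Pi> ! i = []" if "i < length \<Pi>" for i
    using that by (simp add: all_set_conv_all_nth)
  then show ?case by (intro exI[of _ \<Pi>]) simp
next
  case (Suc m)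
  then have "A \<noteq> {}" by auto
  then obtain v where v: "v \<in> A"
      "card {c. c < length \<Pi> \<and> v \<in> set (\<Pi> ! c) \<and> v \<noteq> last (\<Pi> ! c)} \<le> 3"
    using exists_near_sink Suc.prems by blast
  have dist: "distinct (\<Pi> ! i)" "set (\<Pi> ! i) \<subseteq> A" if "i < length \<Pi>" for i
    using Suc.prems that by simp_all
  define \<Pi>0 where "\<Pi>0 = map (filter (\<lambda>x. x \<noteq> v)) \<Pi>"
  have len0: "length \<Pi>0 = length \<Pi>" unfolding \<Pi>0_def by simp
  have nth0: "\<Pi>0 ! i = filter (\<lambda>x. x \<noteq> v) (\<Pi> ! i)" if "i < length \<Pi>" for i
    using that unfolding \<Pi>0_def by simp
  have card0: "card (A - {v}) = m" using Suc v by simp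
  have "\<forall>\<pi>\<in>set \<Pi>0. distinct \<pi> \<and> set \<pi> \<subseteq> A - {v}"
    using Suc.prems unfolding \<Pi>0_def by auto
  moreover have "bridge_girth_gt \<Pi>0 \<infinity>"
    using bridge_girth_infinity_mono[OF Suc.prems(3)] len0 nth0 by simp
  ultimately obtain \<Pi>1 and f :: "nat \<Rightarrow> nat" where IH0: "length \<Pi>1 = length \<Pi>0"
      "\<forall>i<length \<Pi>0. subseq (\<Pi>1 ! i) (\<Pi>0 ! i) \<and> sorted_wrt (\<lambda>x y. f x < f y) (\<Pi>1 ! i)"
      "ps_size \<Pi>0 \<le> ps_size \<Pi>1 + 3 * card (A - {v})"
    using Suc.hyps(1)[OF card0[symmetric] finite_Diff[OF Suc.prems(1)]] by blast
  have IH: "length \<Pi>1 = length \<Pi>"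
      "\<And>i. i < length \<Pi> \<Longrightarrow> subseq (\<Pi>1 ! i) (\<Pi>0 ! i)"
      "\<And>i. i < length \<Pi> \<Longrightarrow> sorted_wrt (\<lambda>x y. f x < f y) (\<Pi>1 ! i)"
      "ps_size \<Pi>0 \<le> ps_size \<Pi>1 + 3 * m"
    using IH0 len0 card0 by simp_all
  \<comment> \<open>The sum bounds \<open>f x\<close> for each \<open>x\<close> in \<open>A\<close>,
    so \<open>v\<close> receives a rank above all of them.\<close>
  define f' where "f' = f(v := Suc (\<Sum>x\<in>A. f x))"
  define ends where "ends = (\<lambda>i. v \<in> set (\<Pi> ! i) \<and> v = last (\<Pi> ! i))"
  define \<Pi>' where "\<Pi>' = map (\<lambda>i. if ends i then \<Pi>1 ! i @ [v] else \<Pi>1 ! i) [0..<length \<Pi>]"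
  have len': "length \<Pi>' = length \<Pi>" unfolding \<Pi>'_def by simp
  have nth': "\<Pi>' ! i = (if ends i then \<Pi>1 ! i @ [v] else \<Pi>1 ! i)" if "i < length \<Pi>" for i
    using that unfolding \<Pi>'_def by simp
  have sub1: "subseq (\<Pi>1 ! i) (\<Pi> ! i)" if "i < length \<Pi>" for i
    using subseq_order.trans[OF IH(2)[OF that]] nth0[OF that] by simp
  have set1: "x \<in> A" "x \<noteq> v" if "i < length \<Pi>" "x \<in> set (\<Pi>1 ! i)" for i x
  proof -
    have "x \<in> set (\<Pi>0 ! i)"
      using subseq_set_subset[OF IH(2)[OF that(1)]] that(2) by blast
    then show "x \<in> A" "x \<noteq> v" using nth0 dist that(1) by auto
  qed
  have "subseq (\<Pi>' ! i) (\<Pi> ! i)" if i: "i < length \<Pi>" for i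
  proof (cases "ends i")
    case True
    then have "\<Pi> ! i \<noteq> []" "v = last (\<Pi> ! i)" unfolding ends_def by auto
    then have eq: "butlast (\<Pi> ! i) @ [v] = \<Pi> ! i" by simp
    have "distinct (butlast (\<Pi> ! i) @ [v])" using dist(1)[OF i] unfolding eq .
    then have "filter (\<lambda>x. x \<noteq> v) (butlast (\<Pi> ! i) @ [v]) = butlast (\<Pi> ! i)"
      by (auto simp: filter_id_conv)
    then have "filter (\<lambda>x. x \<noteq> v) (\<Pi> ! i) = butlast (\<Pi> ! i)" unfolding eq .
    then have "subseq (\<Pi>1 ! i) (butlast (\<Pi> ! i))" using IH(2)[OF i] nth0[OF i] by simp
    then have "subseq (\<Pi>1 ! i @ [v]) (butlast (\<Pi> ! i) @ [v])"
      by (rule list_emb_append_mono) simp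
    then show ?thesis using eq nth'[OF i] True by simp
  next
    case False
    then show ?thesis using nth'[OF i] sub1[OF i] by simp
  qed
  moreover have "sorted_wrt (\<lambda>x y. f' x < f' y) (\<Pi>' ! i)" if i: "i < length \<Pi>" for i
  proof -
    have "sorted_wrt (\<lambda>x y. f' x < f' y) (\<Pi>1 ! i)"
      using sorted_wrt_mono_rel[OF _ IH(3)[OF i], of "\<lambda>x y. f' x < f' y"] set1(2)[OF i]
      unfolding f'_def by simp
    moreover have "f' x < f' v" if "x \<in> set (\<Pi>1 ! i)" for x
      using set1[OF i that] member_le_sum[of x A f] Suc.prems(1) unfolding f'_def by simp
    ultimately show ?thesis using nth'[OF i] by (simp add: sorted_wrt_append)
  qed
  moreover have "ps_size \<Pi> \<le> ps_size \<Pi>' + 3 * card A"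
  proof -
    let ?T = "{c. c < length \<Pi> \<and> v \<in> set (\<Pi> ! c) \<and> v \<noteq> last (\<Pi> ! c)}"
    \<comment> \<open>Stated additively to avoid truncated subtraction: removing and restoring
      \<open>v\<close> loses an incidence exactly on the paths in \<open>?T\<close>.\<close>
    have "length (\<Pi> ! i) + length (\<Pi>1 ! i) =
        length (\<Pi>0 ! i) + length (\<Pi>' ! i) + (if i \<in> ?T then 1 else 0)" if i: "i < length \<Pi>" for i
    proof -
      have "length (filter (\<lambda>x. x = v) (\<Pi> ! i)) = (if v \<in> set (\<Pi> ! i) then 1 else 0)"
        using dist(1)[OF i] by (simp add: distinct_length_filter Collect_conv_if Int_commute)
      then have "length (\<Pi> ! i) = length (\<Pi>0 ! i) + (if v \<in> set (\<Pi> ! i) then 1 else 0)"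
        using sum_length_filter_compl[of "\<lambda>x. x = v" "\<Pi> ! i"] nth0[OF i] by simp
      then show ?thesis using nth'[OF i] i unfolding ends_def by auto
    qed
    then have "(\<Sum>i<length \<Pi>. length (\<Pi> ! i) + length (\<Pi>1 ! i)) =
        (\<Sum>i<length \<Pi>. length (\<Pi>0 ! i) + length (\<Pi>' ! i) + (if i \<in> ?T then 1 else 0))"
      by (intro sum.cong) auto
    moreover have "(\<Sum>i<length \<Pi>. if i \<in> ?T then 1 else (0::nat)) = card ?T"
    proof -
      have "?T = {..<length \<Pi>} \<inter> {c. v \<in> set (\<Pi> ! c) \<and> v \<noteq> last (\<Pi> ! c)}" by auto
      then show ?thesis by (simp add: sum.If_cases)
    qed
    ultimately have "ps_size \<Pi> + ps_size \<Pi>1 = ps_size \<Pi>0 + ps_size \<Pi>' + card ?T"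
      unfolding ps_size_nth len0 len' IH(1) by (simp add: sum.distrib)
    moreover have "card A = Suc m" using Suc.hyps by simp
    ultimately show ?thesis using IH(4) v(2) by linarith
  qed
  ultimately show ?case using len' by blast
qed

section \<open>Shortcutting a ranked system\<close>

definition path_edges :: "nat list list \<Rightarrow> (nat \<times> nat) set" where
  "path_edges \<Pi> = {(x, y). \<exists>c<length \<Pi>. adjacent (\<Pi> ! c) x y}"

text \<open>The index set serves to forbid a path: with \<open>-{c}\<close> the transitive closure
  consists of the connections that avoid path \<open>c\<close>, the candidates for bridges closed by
  \<open>c\<close>.\<close>

definition precedence :: "nat list list \<Rightarrow> nat set \<Rightarrow> (nat \<times> nat) set" where
  "precedence \<Pi> J = {(x, y). \<exists>c\<in>J. c < length \<Pi> \<and> precedes (\<Pi> ! c) x y}"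

lemma route_until:
  "route \<Pi> vs cs \<Longrightarrow> c \<in> set cs \<Longrightarrow> \<exists>ws ds. route \<Pi> ws ds \<and> hd ws = hd vs \<and>
     set ws \<subseteq> set vs \<and> set ds \<subseteq> set cs \<and> c \<notin> set ds \<and> last ws \<in> set (\<Pi> ! c)"
proof (induction rule: route.induct)
  case (snoc vs cs d y)
  show ?case
  proof (cases "c = d")
    case True
    then show ?thesis
      using snoc.hyps precedes_in_set(1)[OF snoc.hyps(3)] route_nonempty[OF snoc.hyps(1)]
      by (intro exI[of _ vs] exI[of _ cs]) auto
  next
    case False
    then obtain ws ds where "route \<Pi> ws ds" "hd ws = hd vs" "set ws \<subseteq> set vs"
        "set ds \<subseteq> set cs" "c \<notin> set ds" "last ws \<in> set (\<Pi> ! c)"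
      using snoc by auto
    then show ?thesis
      using route_nonempty[OF snoc.hyps(1)]
      by (intro exI[of _ ws] exI[of _ ds]) auto
  qed
qed simp

locale ranked_system =
  fixes \<Pi> :: "nat list list" and f :: "nat \<Rightarrow> nat"
  assumes bridgeless: "bridge_girth_gt \<Pi> \<infinity>"
    and ranked: "\<And>c. c < length \<Pi> \<Longrightarrow> sorted_wrt (\<lambda>x y. f x < f y) (\<Pi> ! c)"
begin

lemma rank_less_iff:
  assumes "c < length \<Pi>" "i < length (\<Pi> ! c)" "j < length (\<Pi> ! c)"
  shows "f (\<Pi> ! c ! i) < f (\<Pi> ! c ! j) \<longleftrightarrow> i < j"
  using sorted_wrt_nth_less[OF ranked[OF assms(1)], of i j]
    sorted_wrt_nth_less[OF ranked[OF assms(1)], of j i] assms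
  by (cases i j rule: linorder_cases) auto

lemma distinct_path: "c < length \<Pi> \<Longrightarrow> distinct (\<Pi> ! c)"
  using ranked[of c] strict_sorted_iff[of "map f (\<Pi> ! c)"] by (simp add: sorted_wrt_map distinct_map)

lemma distinct_paths: "\<forall>\<pi>\<in>set \<Pi>. distinct \<pi>"
  using distinct_path by (simp add: all_set_conv_all_nth)

lemma precedes_iff_rank:
  assumes "c < length \<Pi>"
  shows "precedes (\<Pi> ! c) x y \<longleftrightarrow> x \<in> set (\<Pi> ! c) \<and> y \<in> set (\<Pi> ! c) \<and> f x < f y"
proof
  assume "precedes (\<Pi> ! c) x y"
  then obtain i j where "i < j" "j < length (\<Pi> ! c)" "\<Pi> ! c ! i = x" "\<Pi> ! c ! j = y"
    unfolding precedes_def by blast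
  then show "x \<in> set (\<Pi> ! c) \<and> y \<in> set (\<Pi> ! c) \<and> f x < f y"
    using rank_less_iff[OF assms, of i j] by auto
next
  assume "x \<in> set (\<Pi> ! c) \<and> y \<in> set (\<Pi> ! c) \<and> f x < f y"
  then obtain i j where "i < length (\<Pi> ! c)" "\<Pi> ! c ! i = x" "j < length (\<Pi> ! c)" "\<Pi> ! c ! j = y"
      "f x < f y"
    by (auto simp: in_set_conv_nth)
  then show "precedes (\<Pi> ! c) x y"
    unfolding precedes_def using rank_less_iff[OF assms, of i j] by blast
qed

lemma precedence_rank: "(x, y) \<in> precedence \<Pi> J \<Longrightarrow> f x < f y"
  unfolding precedence_def using precedes_iff_rank by blast

lemma precedence_trancl_rank: "(x, y) \<in> (precedence \<Pi> J)\<^sup>+ \<Longrightarrow> f x < f y"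
  by (induction rule: trancl_induct) (auto dest: precedence_rank)

lemma path_edges_subset: "path_edges \<Pi> \<subseteq> precedence \<Pi> UNIV"
  unfolding path_edges_def precedence_def using adjacent_imp_precedes by blast

lemma path_edges_rtrancl_rank: "(x, y) \<in> (path_edges \<Pi>)\<^sup>* \<Longrightarrow> f x \<le> f y"
proof (induction rule: rtrancl_induct)
  case (step y z)
  then have "f y < f z" using path_edges_subset precedence_rank by blast
  then show ?case using step by simp
qed simp

text \<open>If the next step uses a path \<open>c\<close> that the route already contains, cut the
  route where it first meets its arc on \<open>c\<close> and go along \<open>c\<close> directly to
  \<open>z\<close>. The rank guarantees that the cut point precedes \<open>z\<close> on
  \<open>c\<close> and that \<open>z\<close> is new; hence the rank bound carried through the
  induction.\<close>

lemma precedence_trancl_route: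
  assumes "(a, b) \<in> (precedence \<Pi> J)\<^sup>+"
  shows "\<exists>vs cs. route \<Pi> vs cs \<and> cs \<noteq> [] \<and> hd vs = a \<and> last vs = b \<and> set cs \<subseteq> J \<and>
    (\<forall>v\<in>set vs. f v \<le> f b)"
  using assms
proof (induction rule: trancl_induct)
  case (base y)
  then obtain c where c: "c \<in> J" "c < length \<Pi>" "precedes (\<Pi> ! c) a y"
    unfolding precedence_def by blast
  have "f a < f y" using base precedence_rank by blast
  then have "route \<Pi> [a, y] [c]"
    using route.snoc[OF route.start[of \<Pi> a], of c y] c by auto
  then show ?case using c \<open>f a < f y\<close>
    by (intro exI[of _ "[a, y]"] exI[of _ "[c]"]) auto
next
  case (step y z)
  then obtain vs cs where IH: "route \<Pi> vs cs" "cs \<noteq> []" "hd vs = a" "last vs = y" "set cs \<subseteq> J"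
      "\<forall>v\<in>set vs. f v \<le> f y" by blast
  obtain c where c: "c \<in> J" "c < length \<Pi>" "precedes (\<Pi> ! c) y z"
    using step.hyps(2) unfolding precedence_def by blast
  have yz: "f y < f z" using step.hyps(2) precedence_rank by blast
  obtain ws ds where r: "route \<Pi> ws ds" "hd ws = a" "set ws \<subseteq> set vs" "set ds \<subseteq> set cs"
      "c \<notin> set ds" "last ws \<in> set (\<Pi> ! c)"
  proof (cases "c \<in> set cs")
    case True
    then show ?thesis using route_until[OF IH(1)] IH(3) that by blast
  next
    case False
    then show ?thesis using that IH precedes_in_set(1)[OF c(3)] by blast
  qed
  have ne: "ws \<noteq> []" using r(1) route_nonempty by blast
  have le: "f v < f z" if "v \<in> set ws" for v using that r(3) IH(6) yz by fastforce
  then have "precedes (\<Pi> ! c) (last ws) z"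
    using precedes_iff_rank[OF c(2)] r(6) precedes_in_set(2)[OF c(3)] ne by simp
  moreover have "z \<notin> set ws" using le by blast
  ultimately have "route \<Pi> (ws @ [z]) (ds @ [c])" using route.snoc[OF r(1) c(2)] r(5) by blast
  then show ?case
    using ne r(2,4) IH(5) c(1) le
    by (intro exI[of _ "ws @ [z]"] exI[of _ "ds @ [c]"]) (auto intro: less_imp_le)
qed

text \<open>An edge with an end off path \<open>c\<close> belongs to another path. So if
  \<open>x\<close> were off \<open>c\<close>, the walk would contain a piece through
  \<open>x\<close> that avoids \<open>c\<close> as a path and joins two nodes of \<open>c\<close>.
  By rank these two are ordered alike on \<open>c\<close>, which closes a bridge.\<close>

lemma no_detour:
  assumes c: "c < length \<Pi>" "a \<in> set (\<Pi> ! c)" "b \<in> set (\<Pi> ! c)"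
    and x: "(a, x) \<in> (path_edges \<Pi>)\<^sup>*" "(x, b) \<in> (path_edges \<Pi>)\<^sup>*"
  shows "x \<in> set (\<Pi> ! c)"
proof (rule ccontr)
  assume xc: "x \<notin> set (\<Pi> ! c)"
  have off: "(y, z) \<in> precedence \<Pi> (-{c})"
    if "(y, z) \<in> path_edges \<Pi>" "y \<notin> set (\<Pi> ! c) \<or> z \<notin> set (\<Pi> ! c)" for y z
    using that subsetD[OF path_edges_subset that(1)] precedes_in_set
    unfolding precedence_def by blast
  have "x \<notin> set (\<Pi> ! c) \<longrightarrow> (\<exists>a'\<in>set (\<Pi> ! c). (a', x) \<in> (precedence \<Pi> (-{c}))\<^sup>+)"
    using x(1)
  proof (induction rule: rtrancl_induct)
    case (step y z)
    then show ?case using off[OF step.hyps(2)] by (meson r_into_trancl trancl.trancl_into_trancl)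
  qed (use c in simp)
  then obtain a' where a': "a' \<in> set (\<Pi> ! c)" "(a', x) \<in> (precedence \<Pi> (-{c}))\<^sup>+"
    using xc by blast
  have "x \<notin> set (\<Pi> ! c) \<longrightarrow> (\<exists>b'\<in>set (\<Pi> ! c). (x, b') \<in> (precedence \<Pi> (-{c}))\<^sup>+)"
    using x(2)
  proof (induction rule: converse_rtrancl_induct)
    case (step y z)
    then show ?case using off[OF step.hyps(1)] by (meson r_into_trancl trancl_into_trancl2)
  qed (use c in simp)
  then obtain b' where b': "b' \<in> set (\<Pi> ! c)" "(x, b') \<in> (precedence \<Pi> (-{c}))\<^sup>+"
    using xc by blast
  have ab: "(a', b') \<in> (precedence \<Pi> (-{c}))\<^sup>+" using a' b' by (meson trancl_trans)
  then obtain vs cs where "route \<Pi> vs cs" "cs \<noteq> []" "hd vs = a'" "last vs = b'" "set cs \<subseteq> -{c}"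
    using precedence_trancl_route by blast
  moreover have "precedes (\<Pi> ! c) a' b'"
    using precedes_iff_rank[OF c(1)] a' b' precedence_trancl_rank[OF ab] by simp
  ultimately show False using bridgeless_route[OF bridgeless _ _ c(1)] by blast
qed

text \<open>Shortcuts join reachable pairs, so every node of the walk lies between positions
  \<open>i\<close> and \<open>j\<close> of the path by \<open>no_detour\<close> and rank. A step of
  the walk is therefore an edge joining two nodes of path \<open>c\<close> in order, hence an edge
  of \<open>c\<close> itself, and advances by exactly one position.\<close>

lemma unshortcut_distance:
  assumes c: "c < length \<Pi>" "i \<le> j" "j < length (\<Pi> ! c)"
    and H: "H \<subseteq> (path_edges \<Pi>)\<^sup>+"
    and walk: "(\<Pi> ! c ! i, \<Pi> ! c ! j) \<in> (path_edges \<Pi> \<union> H) ^^ k"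
    and unused: "\<And>a b. i \<le> a \<Longrightarrow> a < b \<Longrightarrow> b \<le> j \<Longrightarrow> (\<Pi> ! c ! a, \<Pi> ! c ! b) \<notin> H"
  shows "j \<le> i + k"
proof -
  let ?\<pi> = "\<Pi> ! c" and ?E = "path_edges \<Pi>"
  obtain g where g: "g 0 = ?\<pi> ! i" "g k = ?\<pi> ! j" "\<And>q. q < k \<Longrightarrow> (g q, g (Suc q)) \<in> ?E \<union> H"
    using walk unfolding relpow_fun_conv by blast
  have EH: "(?E \<union> H) \<subseteq> ?E\<^sup>+" using H by auto
  then have "?E \<union> H \<subseteq> ?E\<^sup>*" 
    by (rule subset_trans) (auto intro: trancl_into_rtrancl)
  then have EH': "(?E \<union> H)\<^sup>* \<subseteq> ?E\<^sup>*" by (rule rtrancl_subset_rtrancl)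
  have pos: "\<exists>r. i \<le> r \<and> r \<le> j \<and> g q = ?\<pi> ! r" if q: "q \<le> k" for q
  proof -
    have "(?\<pi> ! i, g q) \<in> (?E \<union> H) ^^ q"
      unfolding relpow_fun_conv using g q by (intro exI[of _ g]) auto
    then have 1: "(?\<pi> ! i, g q) \<in> ?E\<^sup>*" using EH' relpow_imp_rtrancl by blast
    have "(g q, ?\<pi> ! j) \<in> (?E \<union> H) ^^ (k - q)"
      unfolding relpow_fun_conv using g q by (intro exI[of _ "\<lambda>r. g (q + r)"]) auto
    then have 2: "(g q, ?\<pi> ! j) \<in> ?E\<^sup>*" using EH' relpow_imp_rtrancl by blast
    have "g q \<in> set ?\<pi>" using no_detour[OF c(1) _ _ 1 2] c by simp
    then obtain r where r: "r < length ?\<pi>" "g q = ?\<pi> ! r" by (metis in_set_conv_nth)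
    have "i \<le> r" using path_edges_rtrancl_rank[OF 1] rank_less_iff[OF c(1), of r i] r c by simp
    moreover have "r \<le> j"
      using path_edges_rtrancl_rank[OF 2] rank_less_iff[OF c(1), of j r] r c by simp
    ultimately show ?thesis using r by blast
  qed
  have "\<exists>r. r \<le> i + q \<and> i \<le> r \<and> r \<le> j \<and> g q = ?\<pi> ! r" if "q \<le> k" for q
    using that
  proof (induction q)
    case 0
    then show ?case using g(1) c by auto
  next
    case (Suc q)
    then obtain r where r: "r \<le> i + q" "i \<le> r" "r \<le> j" "g q = ?\<pi> ! r" by auto
    obtain r' where r': "i \<le> r'" "r' \<le> j" "g (Suc q) = ?\<pi> ! r'" using pos Suc.prems by blast
    have e: "(g q, g (Suc q)) \<in> ?E \<union> H" using g(3) Suc.prems by simp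
    have "f (g q) < f (g (Suc q))"
      using precedence_trancl_rank trancl_mono[OF subsetD[OF EH e] path_edges_subset] by blast
    then have rr: "r < r'" using rank_less_iff[OF c(1), of r r'] r r' c by simp
    have "(g q, g (Suc q)) \<notin> H" using unused[of r r'] rr r r' by simp
    then obtain d where d: "d < length \<Pi>" "adjacent (\<Pi> ! d) (?\<pi> ! r) (?\<pi> ! r')"
      using e r r' unfolding path_edges_def by auto
    have "precedes ?\<pi> (?\<pi> ! r) (?\<pi> ! r')" 
      unfolding precedes_def using rr r' c by (intro exI[of _ r] exI[of _ r']) simp
    then have "d = c"
      using bridgeless_common_pair[OF bridgeless distinct_paths d(1) c(1)]
        adjacent_imp_precedes[OF d(2)] by blast
    then obtain s where s: "Suc s < length ?\<pi>" "?\<pi> ! s = ?\<pi> ! r" "?\<pi> ! Suc s = ?\<pi> ! r'"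
      using d unfolding adjacent_def by blast
    then have "s = r" "Suc s = r'"
      using nth_eq_iff_index_eq[OF distinct_path[OF c(1)], of s r]
        nth_eq_iff_index_eq[OF distinct_path[OF c(1)], of "Suc s" r'] r r' c by simp_all
    then show ?case using r r' by auto
  qed
  then obtain r where "r \<le> i + k" "r \<le> j" "?\<pi> ! j = ?\<pi> ! r" using g(2) by (metis order_refl)
  then show ?thesis
    using nth_eq_iff_index_eq[OF distinct_path[OF c(1)], of j r] c by simp
qed

text \<open>Cut every path into blocks of \<Delta> + 2 nodes. The ends of a block are at distance
  \<Delta> + 1 along the block, hence each block contains a shortcut, and no shortcut is
  contained in two blocks.\<close>

lemma ps_size_le_shortcut:
  assumes diam: "diam_reducing_shortcut_set (path_edges \<Pi>) H \<Delta>"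
    and H: "finite H" "card H \<le> length \<Pi>"
  shows "ps_size \<Pi> \<le> 2 * (\<Delta> + 2) * length \<Pi>"
proof -
  define L where "L = \<Delta> + 2"
  have Lpos: "L > 0" unfolding L_def by simp
  let ?E = "path_edges \<Pi>" and ?p = "length \<Pi>"
  have HE: "H \<subseteq> ?E\<^sup>+" using diam unfolding diam_reducing_shortcut_set_def by blast
  \<comment> \<open>Only complete blocks are indexed: block \<open>k\<close> of path
    \<open>c\<close> occupies the positions from \<open>k * L\<close> up to
    \<open>Suc k * L - 1\<close>.\<close>
  define B where "B = (SIGMA c:{..<?p}. {..<length (\<Pi> ! c) div L})"
  have "\<exists>a b. k * L \<le> a \<and> a < b \<and> b < Suc k * L \<and> b < length (\<Pi> ! c) \<and> (\<Pi> ! c ! a, \<Pi> ! c ! b) \<in> H"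
    if ck: "(c, k) \<in> B" for c k
  proof (rule ccontr)
    assume none: "\<not> ?thesis"
    have c: "c < ?p" "k < length (\<Pi> ! c) div L" using ck unfolding B_def by auto
    then have "Suc k * L \<le> length (\<Pi> ! c) div L * L" by (intro mult_le_mono1) simp
    also have "\<dots> \<le> length (\<Pi> ! c)" by simp
    finally have len: "k * L + L \<le> length (\<Pi> ! c)" by simp
    let ?i = "k * L" and ?j = "k * L + L - 1"
    have ij: "?i \<le> ?j" "?j < length (\<Pi> ! c)" using len Lpos by linarith+
    have "(\<Pi> ! c ! ?i, \<Pi> ! c ! (?i + q)) \<in> ?E\<^sup>*" if "?i + q \<le> ?j" for q
      using that
    proof (induction q)
      case (Suc q)
      have "adjacent (\<Pi> ! c) (\<Pi> ! c ! (?i + q)) (\<Pi> ! c ! (?i + Suc q))"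
        unfolding adjacent_def using Suc.prems ij by (intro exI[of _ "?i + q"]) simp
      then have "(\<Pi> ! c ! (?i + q), \<Pi> ! c ! (?i + Suc q)) \<in> ?E"
        unfolding path_edges_def using c by blast
      moreover have "(\<Pi> ! c ! ?i, \<Pi> ! c ! (?i + q)) \<in> ?E\<^sup>*" using Suc by simp
      ultimately show ?case by (rule rtrancl.rtrancl_into_rtrancl[rotated])
    qed simp
    from this[of "L - 1"] have "(\<Pi> ! c ! ?i, \<Pi> ! c ! ?j) \<in> ?E\<^sup>*" using Lpos by simp
    then obtain q where q: "q \<le> \<Delta>" "(\<Pi> ! c ! ?i, \<Pi> ! c ! ?j) \<in> (?E \<union> H) ^^ q"
      using diam unfolding diam_reducing_shortcut_set_def by blast
    have "?j \<le> ?i + q"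
    proof (rule unshortcut_distance[OF c(1) ij HE q(2)])
      fix a b assume "?i \<le> a" "a < b" "b \<le> ?j"
      then show "(\<Pi> ! c ! a, \<Pi> ! c ! b) \<notin> H" using none ij Lpos by auto
    qed
    then show False using q(1) unfolding L_def by simp
  qed
  then have "\<exists>ab. snd x * L \<le> fst ab \<and> fst ab < snd ab \<and> snd ab < Suc (snd x) * L \<and>
      snd ab < length (\<Pi> ! fst x) \<and> (\<Pi> ! fst x ! fst ab, \<Pi> ! fst x ! snd ab) \<in> H"
    if "x \<in> B" for x
    using that by (cases x) fastforce
  then obtain h where h: "\<And>x. x \<in> B \<Longrightarrow> snd x * L \<le> fst (h x) \<and> fst (h x) < snd (h x) \<and>
      snd (h x) < Suc (snd x) * L \<and> snd (h x) < length (\<Pi> ! fst x) \<and>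
      (\<Pi> ! fst x ! fst (h x), \<Pi> ! fst x ! snd (h x)) \<in> H"
    by metis
  let ?s = "\<lambda>x. (\<Pi> ! fst x ! fst (h x), \<Pi> ! fst x ! snd (h x))"
  have "inj_on ?s B"
  proof (rule inj_onI)
    fix x y assume xy: "x \<in> B" "y \<in> B" "?s x = ?s y"
    have cx: "fst x < ?p" "fst y < ?p" using xy unfolding B_def by auto
    have pr: "precedes (\<Pi> ! fst x) (fst (?s x)) (snd (?s x))" if "x \<in> B" for x
      unfolding precedes_def using h[OF that] by auto
    have "precedes (\<Pi> ! fst y) (fst (?s x)) (snd (?s x))" using pr[OF xy(2)] xy(3) by simp
    then have eq: "fst x = fst y"
      using bridgeless_common_pair[OF bridgeless distinct_paths cx] pr[OF xy(1)] by blast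
    have "fst (h x) = fst (h y)"
      using nth_eq_iff_index_eq[OF distinct_path[OF cx(1)], of "fst (h x)" "fst (h y)"]
        h[OF xy(1)] h[OF xy(2)] xy(3) eq by auto
    \<comment> \<open>The shortcut determines its path, then the position of its first end, and this
      position determines the block.\<close>
    moreover have "fst (h z) div L = snd z" if "z \<in> B" for z
      using h[OF that] by (intro div_nat_eqI) (auto simp: mult.commute)
    ultimately have "snd x = snd y" using xy by metis
    then show "x = y" using eq by (simp add: prod_eq_iff)
  qed
  moreover have "?s ` B \<subseteq> H" using h by blast
  ultimately have "card B \<le> card H" using H(1) card_inj_on_le by blast
  then have cnt: "(\<Sum>c<?p. length (\<Pi> ! c) div L) \<le> ?p" using H(2) unfolding B_def by simp
  \<comment> \<open>The factor 2 arises here: at most \<open>?p\<close> complete blocks in total,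
    and fewer than \<open>L\<close> remaining nodes on each of the \<open>?p\<close> paths.\<close>
  have "ps_size \<Pi> \<le> (\<Sum>c<?p. L * (length (\<Pi> ! c) div L) + L)"
    unfolding ps_size_nth
  proof (rule sum_mono)
    fix c
    have "length (\<Pi> ! c) = L * (length (\<Pi> ! c) div L) + length (\<Pi> ! c) mod L" by simp
    moreover have "length (\<Pi> ! c) mod L < L" using Lpos by simp
    ultimately show "length (\<Pi> ! c) \<le> L * (length (\<Pi> ! c) div L) + L" by linarith
  qed
  also have "\<dots> = L * (\<Sum>c<?p. length (\<Pi> ! c) div L) + ?p * L"
    by (simp add: sum.distrib sum_distrib_left)
  also have "\<dots> \<le> L * ?p + ?p * L" using cnt by simp
  finally show ?thesis unfolding L_def by (simp add: algebra_simps)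
qed

end

section \<open>The lower bound\<close>

text \<open>The \<open>LEAST\<close> in \<open>SS\<close> needs some admissible value:
  \<open>n * n\<close> works with no shortcuts, since a shortest walk has at most
  \<open>card E\<close> edges. Finiteness of \<open>H\<close> must be stated because
  \<open>card\<close> of an infinite set is 0; it follows from \<open>H\<close> being part of the
  closure of a finite relation.\<close>

lemma SS_shortcut_set:
  assumes "E \<subseteq> {..<n} \<times> {..<n}"
  shows "\<exists>H. finite H \<and> card H \<le> p \<and> diam_reducing_shortcut_set E H (SS n p)"
proof -
  have fin: "finite E" if "E \<subseteq> {..<n} \<times> {..<n}" for E :: "(nat \<times> nat) set"
    using that finite_subset by blast
  have "\<exists>H. card H \<le> p \<and> diam_reducing_shortcut_set E H (n * n)" if E: "E \<subseteq> {..<n} \<times> {..<n}" for E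
  proof -
    have card: "card E \<le> n * n"
      using card_mono[OF _ E] by (simp add: card_cartesian_product)
    have "\<exists>k\<le>n * n. (s, t) \<in> E ^^ k" if "(s, t) \<in> E\<^sup>*" for s t
    proof -
      obtain k where "(s, t) \<in> E ^^ k" using \<open>(s, t) \<in> E\<^sup>*\<close> rtrancl_imp_relpow by blast
      then obtain l where "l \<le> card E" "(s, t) \<in> E ^^ l"
        using relpow_finite_bounded[OF fin[OF E], of k] by auto
      then show ?thesis using card by (meson order_trans)
    qed
    then have "diam_reducing_shortcut_set E {} (n * n)"
      unfolding diam_reducing_shortcut_set_def by simp
    then show ?thesis by (intro exI[of _ "{}"]) simp
  qed
  then have "\<forall>E. E \<subseteq> {..<n} \<times> {..<n} \<longrightarrow>
      (\<exists>H. card H \<le> p \<and> diam_reducing_shortcut_set E H (n * n))" by blast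
  then have "\<forall>E. E \<subseteq> {..<n} \<times> {..<n} \<longrightarrow>
      (\<exists>H. card H \<le> p \<and> diam_reducing_shortcut_set E H (SS n p))"
    unfolding SS_def by (rule LeastI)
  then obtain H where H: "card H \<le> p" "diam_reducing_shortcut_set E H (SS n p)"
    using assms by blast
  then have "H \<subseteq> E\<^sup>+" unfolding diam_reducing_shortcut_set_def by blast
  then have "finite H" using fin[OF assms] finite_trancl finite_subset by blast
  then show ?thesis using H by blast
qed

lemma ranked_size_le_SS:
  assumes "ranked_system \<Pi> f" "path_system n p \<Pi>"
  shows "ps_size \<Pi> \<le> 2 * (SS n p + 2) * p"
proof -
  have p: "length \<Pi> = p" and sub: "\<And>c. c < p \<Longrightarrow> set (\<Pi> ! c) \<subseteq> {..<n}"
    using assms(2) unfolding path_system_def by (auto dest: nth_mem)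
  have "path_edges \<Pi> \<subseteq> {..<n} \<times> {..<n}"
    unfolding path_edges_def p using sub adjacent_imp_precedes precedes_in_set by blast
  then obtain H where "finite H" "card H \<le> p" "diam_reducing_shortcut_set (path_edges \<Pi>) H (SS n p)"
    using SS_shortcut_set by blast
  then show ?thesis using ranked_system.ps_size_le_shortcut[OF assms(1)] p by simp
qed

text \<open>This pays for the \<open>3 * n\<close> incidences lost to the ranking. The test system
  is bridgeless because a bridge on two or more nodes needs two nonempty paths; it is ranked by the
  identity.\<close>

lemma node_count_le_SS:
  assumes "p \<ge> 1"
  shows "n \<le> 2 * (SS n p + 2) * p"
proof -
  \<comment> \<open>Empty paths pad the system to exactly \<open>p\<close> paths, as many as there
    are shortcuts.\<close>
  define \<Pi> where "\<Pi> = [0..<n] # replicate (p - 1) []"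
  have len: "length \<Pi> = p" using assms unfolding \<Pi>_def by simp
  have nth: "\<Pi> ! c = (if c = 0 then [0..<n] else [])" if "c < p" for c
    using that unfolding \<Pi>_def by (cases c) auto
  have "\<not> has_bridge \<Pi> b" for b
  proof
    assume "has_bridge \<Pi> b"
    then obtain vs cs where b: "b \<ge> 1" "length vs = b" "distinct vs" "length cs = b" "distinct cs"
        "\<forall>i\<in>set cs. i < p"
        "\<And>i. i + 1 < b \<Longrightarrow> precedes (\<Pi> ! (cs ! i)) (vs ! i) (vs ! (i + 1))"
        "precedes (\<Pi> ! (cs ! (b - 1))) (vs ! 0) (vs ! (b - 1))"
      unfolding has_bridge_def len by blast
    have zero: "c = 0" if "c < p" "precedes (\<Pi> ! c) x y" for c x y
      using that nth[OF that(1)] precedes_in_set(1)[OF that(2)] by (auto split: if_splits)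
    have river: "cs ! (b - 1) = 0" using zero[OF _ b(8)] b by simp
    show False
    proof (cases "b = 1")
      case True
      then have "precedes [0..<n] (vs ! 0) (vs ! 0)" using b(8) river nth[of 0] assms by simp
      then show False using precedes_irrefl by simp
    next
      case False
      then have "cs ! 0 = 0" using zero[OF _ b(7)[of 0]] b by simp
      then show False
        using river nth_eq_iff_index_eq[of cs 0 "b - 1"] b False by simp
    qed
  qed
  then have "bridge_girth_gt \<Pi> \<infinity>" unfolding bridge_girth_gt_def by blast
  then have "ranked_system \<Pi> (\<lambda>x. x)"
    unfolding ranked_system_def using nth len by simp
  moreover have "path_system n p \<Pi>"
    unfolding path_system_def using len unfolding \<Pi>_def by auto
  ultimately have "ps_size \<Pi> \<le> 2 * (SS n p + 2) * p" by (rule ranked_size_le_SS)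
  moreover have "ps_size \<Pi> = n" unfolding ps_size_def \<Pi>_def by (simp add: sum_list_replicate)
  ultimately show ?thesis by simp
qed

text \<open>Allows \<open>SS n p + 2\<close> to be replaced by \<open>3 * SS n p\<close>. For
  \<open>n = 1\<close> the value is 0, while \<open>p\<close> one-node paths show that
  \<open>beta\<close> is positive for positive \<open>p\<close>, so the lower bound has to start at
  \<open>n = 2\<close>.\<close>

lemma SS_pos:
  assumes "n \<ge> 2"
  shows "SS n p \<ge> 1"
proof (rule ccontr)
  assume "\<not> SS n p \<ge> 1"
  then have 0: "SS n p = 0" by simp
  obtain H where "diam_reducing_shortcut_set {(0, 1)} H (SS n p)"
    using SS_shortcut_set[of "{(0, 1)}" n p] assms by auto
  then show False unfolding diam_reducing_shortcut_set_def 0 by auto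
qed

text \<open>\<open>Max\<close> is meaningful only on a finite nonempty set: sizes are at most
  \<open>p * n\<close>, and \<open>p\<close> empty paths form a system without bridges.\<close>

lemma beta_attained: "\<exists>\<Pi>. path_system n p \<Pi> \<and> bridge_girth_gt \<Pi> k \<and> ps_size \<Pi> = beta n p k"
proof -
  let ?S = "{ps_size \<Pi> | \<Pi>. path_system n p \<Pi> \<and> bridge_girth_gt \<Pi> k}"
  have "ps_size \<Pi> \<le> p * n" if "path_system n p \<Pi>" for \<Pi>
  proof -
    have "length (\<Pi> ! i) \<le> n" if "i < length \<Pi>" for i
    proof -
      have "distinct (\<Pi> ! i)" "set (\<Pi> ! i) \<subseteq> {..<n}"
        using \<open>path_system n p \<Pi>\<close> that unfolding path_system_def by auto
      then show ?thesis using card_mono[of "{..<n}" "set (\<Pi> ! i)"] by (simp add: distinct_card)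
    qed
    then show ?thesis
      unfolding ps_size_nth using sum_bounded_above[of "{..<length \<Pi>}" "\<lambda>i. length (\<Pi> ! i)" n] that
      unfolding path_system_def by simp
  qed
  then have "?S \<subseteq> {..p * n}" by auto
  then have "finite ?S" using finite_subset by blast
  moreover have "?S \<noteq> {}"
  proof -
    have "\<not> has_bridge (replicate p []) b" for b
    proof
      assume "has_bridge (replicate p []) b"
      then obtain cs vs where "b \<ge> 1" "length cs = b" "\<forall>i\<in>set cs. i < p"
          "precedes (replicate p [] ! (cs ! (b - 1))) (vs ! 0) (vs ! (b - 1))"
        unfolding has_bridge_def by auto
      then show False unfolding precedes_def by simp
    qed
    then have "path_system n p (replicate p []) \<and> bridge_girth_gt (replicate p []) k"
      unfolding path_system_def bridge_girth_gt_def by simp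
    then show ?thesis by blast
  qed
  ultimately have "Max ?S \<in> ?S" by (rule Max_in)
  then show ?thesis unfolding beta_def by auto
qed

text \<open>With X = \<open>(SS n p + 2) * p\<close>, the ranked part has size at most 2 X and the
  lost incidences number at most 3 n \<le> 6 X. The total 8 X becomes 24 times
  \<open>SS n p * p\<close> by \<open>SS_pos\<close>.\<close>

lemma beta_le_SS:
  assumes "n \<ge> 2" "p \<ge> 1"
  shows "beta n p \<infinity> \<le> 24 * SS n p * p"
proof -
  obtain \<Pi> where \<Pi>: "path_system n p \<Pi>" "bridge_girth_gt \<Pi> \<infinity>" "ps_size \<Pi> = beta n p \<infinity>"
    using beta_attained by blast
  have len: "length \<Pi> = p" and paths: "\<forall>\<pi>\<in>set \<Pi>. distinct \<pi> \<and> set \<pi> \<subseteq> {..<n}"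
    using \<Pi>(1) unfolding path_system_def by auto
  obtain \<Pi>' and f :: "nat \<Rightarrow> nat" where S: "length \<Pi>' = p"
      "\<And>i. i < p \<Longrightarrow> subseq (\<Pi>' ! i) (\<Pi> ! i)"
      "\<And>i. i < p \<Longrightarrow> sorted_wrt (\<lambda>x y. f x < f y) (\<Pi>' ! i)"
      "ps_size \<Pi> \<le> ps_size \<Pi>' + 3 * n"
    using exists_ranked_subsystem[OF _ paths \<Pi>(2)] len by auto
  have rs: "ranked_system \<Pi>' f"
    unfolding ranked_system_def
    using bridge_girth_infinity_mono[OF \<Pi>(2), of \<Pi>'] S len by simp
  have "set (\<Pi>' ! i) \<subseteq> {..<n}" if "i < p" for i
    using subseq_set_subset[OF S(2)[OF that]] paths that len by (meson nth_mem order_trans)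
  then have "path_system n p \<Pi>'"
    unfolding path_system_def using ranked_system.distinct_path[OF rs] S(1)
    by (simp add: all_set_conv_all_nth)
  then have "ps_size \<Pi>' \<le> 2 * (SS n p + 2) * p" using ranked_size_le_SS[OF rs] by blast
  moreover have "n \<le> 2 * (SS n p + 2) * p" using node_count_le_SS assms(2) by blast
  ultimately have "beta n p \<infinity> \<le> 8 * ((SS n p + 2) * p)" using S(4) \<Pi>(3) by simp
  also have "\<dots> \<le> 8 * ((3 * SS n p) * p)"
    using SS_pos[OF assms(1), of p] by (intro mult_le_mono) simp_all
  finally show ?thesis by simp
qed

theorem theorem4p23:
  shows "\<exists>c::real. c > 0 \<and> (\<exists>N. \<forall>n p. n \<ge> N \<longrightarrow> p \<ge> 1 \<longrightarrow>
           real (SS n p) \<ge> c * real (beta n p \<infinity>) / real p)"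
proof (intro exI[of _ "1 / 24 :: real"] conjI exI[of _ 2] allI impI)
  fix n p :: nat assume np: "n \<ge> 2" "p \<ge> 1"
  have "real (beta n p \<infinity>) \<le> real (24 * SS n p * p)"
    using beta_le_SS[OF np] of_nat_mono by blast
  then show "real (SS n p) \<ge> 1 / 24 * real (beta n p \<infinity>) / real p"
    using np by (simp add: field_simps)
qed simp

end
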